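(* Let $r_H>0$, $\beta>0$, $\tau_H=\ln r_H$, and let $(A,B)$ be the warped black hole solution on $[\tau_H,\infty)$ with $A(\tau_H)=0$, $B(\tau_H)=\beta$ of the system $$A B'' + \tfrac15\Big[B'\big(24e^{-2B}-4e^{-12B}\big)-6\big(e^{-2B}-e^{-12B}\big)\Big]=0,$$ $$A'=-4A\big(1+B'^2\big)+\tfrac15\big(24e^{-2B}-4e^{-12B}\big)$$ (primes denote $d/d\tau$). Then $B'$ is monotonically increasing, the limit $\zeta=\lim_{\tau\to\infty}B'(\tau)$ exists and is finite with $\zeta>0$, and there is a constant $\Sigma\in\mathbb{R}$ such that $B(\tau)\sim \zeta\tau+\Sigma$ for large $\tau$, i.e. $B(\tau)-\zeta\tau-\Sigma\to0$ as $\tau\to\infty$.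
   Context: For $r_H>0$ and $\beta>0$, the system has a unique solution $(A,B)$, real analytic near $\tau_H=\ln r_H$, with $A(\tau_H)=0$ and $B(\tau_H)=\beta$. This solution extends to all $\tau\in[\tau_H,\infty)$, and $0<B'<\frac14$, $0<A<1$, $B>0$ for $\tau>\tau_H$; it is called a warped black hole. Here $\tau=\ln r$, and the system is the static vacuum Einstein equations in $6+1$ dimensions for the ansatz $ds^2=-Ae^{-2\delta}dt^2+A^{-1}dr^2+r^2(e^{-8B}\sigma^2+e^{2B}d\Sigma_2^2)$, with the decoupled equation $\delta'=-4B'^2$ omitted. *)

theory Defs
  imports "HOL-Analysis.Analysis"
begin

definition real_analytic_at :: "(real \<Rightarrow> real) \<Rightarrow> real \<Rightarrow> bool" where
  "real_analytic_at f x \<longleftrightarrow> (\<exists>F. (\<lambda>h. f (x + h)) has_fps_expansion F)"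

(* A and B are total functions, but the equations are only required on [tau_H, \<infinity>).
   Real analyticity is in a full neighbourhood of tau_H, so the two-sided derivatives at the
   end point tau_H are determined by the values on [tau_H, \<infinity>); the values further to the
   left play no role.
   The bounds 0 < B' < 1/4, 0 < A < 1 and B > 0 for t > tau_H are consequences of the
   conditions below and of beta > 0, and are therefore not part of the definition. *)
definition warped_black_hole ::
    "real \<Rightarrow> real \<Rightarrow> (real \<Rightarrow> real) \<Rightarrow> (real \<Rightarrow> real) \<Rightarrow> bool" where
  "warped_black_hole tau_H beta A B \<longleftrightarrow>
     A tau_H = 0 \<and> B tau_H = beta \<and>
     real_analytic_at A tau_H \<and> real_analytic_at B tau_H \<and>
     (\<forall>t\<ge>tau_H.
        A differentiable (at t) \<and> B differentiable (at t) \<and> deriv B differentiable (at t) \<and>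
        A t * deriv (deriv B) t
          + 1 / 5 * (deriv B t * (24 * exp (- 2 * B t) - 4 * exp (- 12 * B t))
                     - 6 * (exp (- 2 * B t) - exp (- 12 * B t))) = 0 \<and>
        deriv A t = - 4 * A t * (1 + (deriv B t)\<^sup>2)
          + 1 / 5 * (24 * exp (- 2 * B t) - 4 * exp (- 12 * B t)))"

end

(* With P = B', f(b) = (24 exp(-2b) - 4 exp(-12b)) / 5 and u = exp(-10B), the second-order equation
   reads A P' = f(B) (R(B) - P), where R < 1/4 is increasing. At the horizon P = R. The gap
   D = R(B) - P satisfies D' = R'(B) P - (f(B)/A) D, so D > 0 afterwards; hence P is strictly
   increasing and below 1/4. Moreover 3 A < f(B), so D is damped at rate at least 3 while its source
   R'(B) P is at most 3 u P = -(3/10) u'. Therefore D and 1/4 - R(B) are integrable, which bounds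
   B - t/4, and with it B - zeta t, from below. *)
theory Submission
  imports Defs
begin

lemma positive_of_increasing_where_nonpos:
  fixes h h' :: "real \<Rightarrow> real"
  assumes "a < t" "h a \<ge> 0" and cont: "continuous_on {a..t} h"
    and deriv: "\<And>s. a < s \<Longrightarrow> s \<le> t \<Longrightarrow> (h has_real_derivative h' s) (at s)"
    and pos: "\<And>s. a < s \<Longrightarrow> s \<le> t \<Longrightarrow> h s \<le> 0 \<Longrightarrow> h' s > 0"
  shows "h t > 0"
proof (rule ccontr)
  assume nonpos: "\<not> h t > 0"
  obtain m where m: "m \<in> {a..t}" "\<And>s. s \<in> {a..t} \<Longrightarrow> h m \<le> h s"
    using continuous_attains_inf[OF compact_Icc _ cont] \<open>a < t\<close> by fastforce
  \<comment> \<open>A minimum at \<open>a\<close> forces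
    \<open>h t \<le> 0 \<le> h a \<le> h t\<close>, so \<open>t\<close> is then also a
    minimiser.\<close>
  obtain n where n: "a < n" "n \<le> t" "h n \<le> 0" and n_min: "\<And>s. s \<in> {a..t} \<Longrightarrow> h n \<le> h s"
  proof (cases "m = a")
    case True
    then have "h t \<le> h a" using \<open>h a \<ge> 0\<close> nonpos by simp
    then show ?thesis using that[of t] m True \<open>a < t\<close> nonpos by fastforce
  next
    case False
    moreover have "h m \<le> h t" using m(2)[of t] \<open>a < t\<close> by simp
    ultimately show ?thesis using that[of m] m nonpos by simp
  qed
  obtain d where "d > 0" and d: "\<And>k. k > 0 \<Longrightarrow> k < d \<Longrightarrow> h (n - k) < h n"
    using DERIV_pos_inc_left[OF deriv pos] n by blast
  define k where "k = min (d / 2) (n - a)"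
  have "k > 0" "k < d" "k \<le> n - a" using \<open>d > 0\<close> n unfolding k_def by auto
  then show False using d[of k] n_min[of "n - k"] n by fastforce
qed

text \<open>Looking at the first nonpositive point makes positivity on all of the past available
  when the derivative is estimated. For \<open>B'\<close> this past supplies \<open>B > 0\<close>
  and \<open>A > 0\<close>.\<close>

lemma positive_of_increasing_at_first_zero:
  fixes h h' :: "real \<Rightarrow> real"
  assumes "a \<le> t" "h a > 0" and cont: "continuous_on {a..t} h"
    and deriv: "\<And>s. a < s \<Longrightarrow> s \<le> t \<Longrightarrow> (h has_real_derivative h' s) (at s)"
    and pos: "\<And>s. a < s \<Longrightarrow> s \<le> t \<Longrightarrow> h s \<le> 0 \<Longrightarrow> (\<And>r. a \<le> r \<Longrightarrow> r < s \<Longrightarrow> h r > 0) \<Longrightarrow> h' s > 0"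
  shows "h t > 0"
proof (rule ccontr)
  assume nonpos: "\<not> h t > 0"
  define S where "S = {s \<in> {a..t}. h s \<le> 0}"
  have "S = {a..t} \<inter> h -` {..0}" unfolding S_def by auto
  then have "closed S" using continuous_closed_preimage[OF cont] by simp
  moreover have "bounded S" unfolding S_def by (rule bounded_subset[of "{a..t}"]) auto
  moreover have "S \<noteq> {}" using nonpos \<open>a \<le> t\<close> unfolding S_def by auto
  ultimately obtain n where "n \<in> S" and n_min: "\<And>s. s \<in> S \<Longrightarrow> n \<le> s"
    using compact_attains_inf[of S] compact_eq_bounded_closed by blast
  then have "a \<le> n" and n: "n \<le> t" "h n \<le> 0" unfolding S_def by auto
  then have "a < n" using \<open>h a > 0\<close> by (cases "a = n") auto
  have before: "h r > 0" if "a \<le> r" "r < n" for r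
    using n_min[of r] that n unfolding S_def by fastforce
  obtain d where "d > 0" and d: "\<And>k. k > 0 \<Longrightarrow> k < d \<Longrightarrow> h (n - k) < h n"
    using DERIV_pos_inc_left[OF deriv pos] \<open>a < n\<close> n before by blast
  define k where "k = min (d / 2) (n - a)"
  have "k > 0" "k < d" "k \<le> n - a" using \<open>d > 0\<close> \<open>a < n\<close> unfolding k_def by auto
  then show False using d[of k] before[of "n - k"] n by fastforce
qed

lemma mono_bdd_above_tendsto_at_top:
  fixes f :: "real \<Rightarrow> real"
  assumes mono: "mono_on {a..} f" and bdd: "\<And>x. x \<ge> a \<Longrightarrow> f x \<le> M"
  obtains l where "(f \<longlongrightarrow> l) at_top" "\<And>x. x \<ge> a \<Longrightarrow> f x \<le> l"
proof -
  define l where "l = Sup (f ` {a..})"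
  have bdd': "bdd_above (f ` {a..})" using bdd by (auto intro!: bdd_aboveI)
  then have le: "f x \<le> l" if "x \<ge> a" for x
    unfolding l_def using that by (auto intro: cSup_upper)
  have "(f \<longlongrightarrow> l) at_top"
  proof (rule increasing_tendsto)
    show "\<forall>\<^sub>F x in at_top. f x \<le> l"
      using eventually_ge_at_top[of a] by eventually_elim (rule le)
  next
    fix y assume "y < l"
    then obtain z where z: "z \<ge> a" "y < f z"
      unfolding l_def using less_cSup_iff[OF _ bdd', of y] by auto
    show "\<forall>\<^sub>F x in at_top. y < f x"
      using eventually_ge_at_top[of z]
    proof eventually_elim
      case (elim x)
      then have "f z \<le> f x" using mono z by (auto intro: mono_onD)
      then show ?case using z by simp
    qed
  qed
  then show ?thesis using that le by blast
qed

lemma continuous_on_Icc_of_deriv: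
  fixes f f' :: "real \<Rightarrow> real"
  assumes "\<And>s. s \<ge> a \<Longrightarrow> (f has_real_derivative f' s) (at s)"
  shows "continuous_on {a..t} f"
  by (rule continuous_at_imp_continuous_on) (use assms DERIV_isCont in fastforce)

section \<open>Coefficient functions of the system\<close>

definition friction :: "real \<Rightarrow> real" where
  "friction b = (24 * exp (- 2 * b) - 4 * exp (- 12 * b)) / 5"

text \<open>The value of \<open>B'\<close> at which the equation for \<open>B\<close> makes \<open>B''\<close> vanish.\<close>

definition slope :: "real \<Rightarrow> real" where
  "slope b = 3 / 2 * (1 - exp (- 10 * b)) / (6 - exp (- 10 * b))"

lemma exp_minus_twelve: "exp (- 12 * b) = exp (- 2 * b) * exp (- 10 * b :: real)"
  by (simp flip: exp_add)

lemma friction_pos: "b > 0 \<Longrightarrow> friction b > 0"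
proof -
  assume "b > 0"
  then have "exp (- 12 * b) < exp (- 2 * b)" by simp
  then show ?thesis unfolding friction_def using exp_gt_zero[of "- 2 * b"]
    by (intro divide_pos_pos) linarith+
qed

lemma friction_deriv:
  "(friction has_real_derivative - 2 * friction b + 8 * exp (- 12 * b)) (at b)"
  unfolding friction_def
  by (rule derivative_eq_intros refl | simp)+

text \<open>Both sides carry the factor \<open>exp (- 2 * b)\<close>; what remains is rational in
  \<open>u = exp (- 10 * b)\<close>, and the factor \<open>6 - u\<close> of \<open>friction\<close>
  cancels the denominator of \<open>slope\<close>.\<close>

lemma friction_times_slope:
  assumes "b > 0"
  shows "friction b * slope b = 6 / 5 * (exp (- 2 * b) - exp (- 12 * b))"
proof -
  define u where "u = exp (- 10 * b)"
  have "u < 1" using assms unfolding u_def by simp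
  then have "6 - u \<noteq> 0" by linarith
  then have "(6 - u) * slope b = 3 / 2 * (1 - u)"
    unfolding slope_def u_def[symmetric] times_divide_eq_right
    by (rule nonzero_mult_div_cancel_left)
  moreover have "friction b = 4 / 5 * exp (- 2 * b) * (6 - u)"
    unfolding friction_def exp_minus_twelve u_def[symmetric] by (simp add: algebra_simps)
  ultimately have "friction b * slope b = 4 / 5 * exp (- 2 * b) * (3 / 2 * (1 - u))"
    by (metis mult.assoc)
  then show ?thesis
    unfolding exp_minus_twelve u_def[symmetric] by (simp add: algebra_simps)
qed

lemma slope_pos: "b > 0 \<Longrightarrow> slope b > 0"
proof -
  assume "b > 0"
  then have "exp (- 10 * b) < 1" by simp
  then show ?thesis unfolding slope_def by (intro divide_pos_pos mult_pos_pos) linarith+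
qed

text \<open>The deficit is exactly \<open>5 * u / (4 * (6 - u))\<close> with
  \<open>u = exp (- 10 * b)\<close>, and \<open>6 - u > 5\<close>.\<close>

lemma slope_bounds:
  assumes "b > 0"
  shows "slope b < 1 / 4" "1 / 4 - slope b \<le> exp (- 10 * b) / 4"
proof -
  define u where "u = exp (- 10 * b)"
  have u: "0 < u" "u < 1" using assms unfolding u_def by auto
  have "1 / 4 - slope b = 5 * u / (4 * (6 - u))"
    unfolding slope_def u_def[symmetric] using u by (simp add: field_simps)
  moreover have "5 * u / (4 * (6 - u)) > 0" using u by simp
  moreover have "5 * u / (4 * (6 - u)) \<le> 5 * u / (4 * 5)"
    using u by (intro divide_left_mono) auto
  ultimately show "slope b < 1 / 4" "1 / 4 - slope b \<le> exp (- 10 * b) / 4"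
    unfolding u_def[symmetric] by auto
qed

definition slope' :: "real \<Rightarrow> real" where
  "slope' b = 75 * exp (- 10 * b) / (6 - exp (- 10 * b))\<^sup>2"

lemma slope_deriv:
  assumes "b > 0"
  shows "(slope has_real_derivative slope' b) (at b)"
proof -
  have "exp (- 10 * b) < 1" using assms by simp
  then have "exp (- 10 * b) \<noteq> 6" by linarith
  then show ?thesis
    unfolding slope_def [abs_def] slope'_def
    by (auto intro!: derivative_eq_intros simp: power2_eq_square divide_simps)
       (simp add: algebra_simps)
qed

lemma slope'_bounds:
  assumes "b > 0"
  shows "slope' b > 0" "slope' b \<le> 3 * exp (- 10 * b)"
proof -
  define u where "u = exp (- 10 * b)"
  have u: "0 < u" "u < 1" using assms unfolding u_def by auto
  then have "(6 - u)\<^sup>2 \<ge> 5\<^sup>2" by (intro power_mono) auto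
  then have "75 * u / (6 - u)\<^sup>2 \<le> 75 * u / 25"
    using u by (intro divide_left_mono) auto
  moreover have "75 * u / (6 - u)\<^sup>2 > 0" using u by auto
  ultimately show "slope' b > 0" "slope' b \<le> 3 * exp (- 10 * b)"
    unfolding slope'_def u_def[symmetric] by auto
qed

section \<open>The solution near the horizon and the signs of \<open>A\<close>, \<open>B\<close> and
  \<open>B'\<close>\<close>

locale warped =
  fixes a \<beta> :: real and A B :: "real \<Rightarrow> real"
  assumes beta_pos: "\<beta> > 0" and solution: "warped_black_hole a \<beta> A B"
begin

abbreviation P :: "real \<Rightarrow> real" where "P \<equiv> deriv B"

definition gap :: "real \<Rightarrow> real" where "gap t = slope (B t) - P t"

lemma A_horizon: "A a = 0" and B_horizon: "B a = \<beta>"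
  using solution unfolding warped_black_hole_def by blast+

lemma A_deriv:
  "t \<ge> a \<Longrightarrow> (A has_real_derivative friction (B t) - 4 * A t * (1 + (P t)\<^sup>2)) (at t)"
  and B_deriv: "t \<ge> a \<Longrightarrow> (B has_real_derivative P t) (at t)"
  and P_deriv: "t \<ge> a \<Longrightarrow> (P has_real_derivative deriv P t) (at t)"
proof -
  assume "t \<ge> a"
  then have "A differentiable (at t)" "B differentiable (at t)" "P differentiable (at t)"
    "deriv A t = - 4 * A t * (1 + (P t)\<^sup>2)
      + 1 / 5 * (24 * exp (- 2 * B t) - 4 * exp (- 12 * B t))"
    using solution unfolding warped_black_hole_def by blast+
  then show "(A has_real_derivative friction (B t) - 4 * A t * (1 + (P t)\<^sup>2)) (at t)"
    "(B has_real_derivative P t) (at t)" "(P has_real_derivative deriv P t) (at t)"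
    unfolding friction_def DERIV_deriv_iff_real_differentiable[symmetric] by simp_all
qed

lemma A_cont: "continuous_on {a..t} A" and B_cont: "continuous_on {a..t} B"
  and P_cont: "continuous_on {a..t} P"
  by (rule continuous_on_Icc_of_deriv, erule A_deriv B_deriv P_deriv)+

lemma P_equation:
  assumes "t \<ge> a" "B t > 0"
  shows "A t * deriv P t = friction (B t) * gap t"
proof -
  have "A t * deriv P t = 6 / 5 * (exp (- 2 * B t) - exp (- 12 * B t)) - friction (B t) * P t"
  proof -
    have "A t * deriv P t + 1 / 5 * (P t * (24 * exp (- 2 * B t) - 4 * exp (- 12 * B t))
        - 6 * (exp (- 2 * B t) - exp (- 12 * B t))) = 0"
      using solution \<open>t \<ge> a\<close> unfolding warped_black_hole_def by blast
    then show ?thesis unfolding friction_def by (simp add: field_simps)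
  qed
  then show ?thesis
    unfolding gap_def right_diff_distrib friction_times_slope[OF \<open>B t > 0\<close>] .
qed

text \<open>Where \<open>A \<le> 0\<close> the damping term no longer pulls \<open>A\<close> down,
  so the positive source \<open>friction\<close> gives \<open>A' > 0\<close>. The condition on
  \<open>B\<close> is local in time because it must serve inside the proof of
  \<open>P_pos\<close>.\<close>

lemma A_pos_if:
  assumes "a < t" "\<And>s. a \<le> s \<Longrightarrow> s \<le> t \<Longrightarrow> B s > 0"
  shows "A t > 0"
proof (rule positive_of_increasing_where_nonpos[OF \<open>a < t\<close> _ A_cont])
  show "A a \<ge> 0" by (simp add: A_horizon)
  fix s assume s: "a < s" "s \<le> t"
  show "(A has_real_derivative friction (B s) - 4 * A s * (1 + (P s)\<^sup>2)) (at s)"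
    using s by (intro A_deriv) auto
  assume "A s \<le> 0"
  then have "A s * (1 + (P s)\<^sup>2) \<le> 0" by (intro mult_nonpos_nonneg) auto
  then show "friction (B s) - 4 * A s * (1 + (P s)\<^sup>2) > 0"
    using friction_pos[of "B s"] assms s by force
qed

text \<open>Positivity of \<open>B'\<close> is asked only strictly before \<open>t\<close>, so that
  the bound applies at a first zero of \<open>B'\<close>.\<close>

lemma B_ge_if:
  assumes "a \<le> t" "\<And>s. a \<le> s \<Longrightarrow> s < t \<Longrightarrow> P s > 0"
  shows "B t \<ge> \<beta>"
proof (cases "a = t")
  case False
  then have "B a < B t"
    using assms by (intro DERIV_pos_imp_increasing_open[OF _ _ B_cont]) (force intro!: B_deriv)+
  then show ?thesis by (simp add: B_horizon)
qed (use B_horizon in simp)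

text \<open>At \<open>a\<close> the factor \<open>A\<close> kills the second-order term, so the
  degenerate equation fixes the initial slope \<open>B'(a) = slope \<beta>\<close>.\<close>

lemma gap_horizon: "gap a = 0"
proof -
  have "friction \<beta> * gap a = 0"
    using P_equation[of a] beta_pos unfolding A_horizon B_horizon by simp
  then show ?thesis using friction_pos[OF beta_pos] by simp
qed

lemma P_horizon_pos: "P a > 0"
  using gap_horizon slope_pos[OF beta_pos] unfolding gap_def B_horizon by linarith

text \<open>At a first point with \<open>B' \<le> 0\<close> one still has
  \<open>B \<ge> \<beta>\<close> and \<open>A > 0\<close>, while \<open>slope (B s) > 0\<close>
  makes the gap positive; the equation then gives \<open>B'' > 0\<close>.\<close>

lemma P_pos:
  assumes "t \<ge> a"
  shows "P t > 0"
proof (rule positive_of_increasing_at_first_zero[where h' = "deriv P", OF assms P_horizon_pos P_cont])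
  fix s assume s: "a < s" "s \<le> t"
  show "(P has_real_derivative deriv P s) (at s)"
    using s by (intro P_deriv) auto
  assume "P s \<le> 0" and before: "\<And>r. a \<le> r \<Longrightarrow> r < s \<Longrightarrow> P r > 0"
  have B_pos: "B r > 0" if "a \<le> r" "r \<le> s" for r
    using B_ge_if[of r] before that beta_pos by fastforce
  then have "A s > 0" using A_pos_if s by blast
  have "B s > 0" using B_pos s by simp
  have "gap s > 0" using slope_pos[OF \<open>B s > 0\<close>] \<open>P s \<le> 0\<close> by (simp add: gap_def)
  then have "A s * deriv P s > 0"
    using P_equation[of s] s \<open>B s > 0\<close> friction_pos[OF \<open>B s > 0\<close>] by simp
  then show "deriv P s > 0" using \<open>A s > 0\<close> by (simp add: zero_less_mult_iff)
qed

lemma B_pos: "t \<ge> a \<Longrightarrow> B t > 0"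
  by (rule less_le_trans[OF beta_pos B_ge_if]) (auto intro: P_pos)

lemma A_pos: "t > a \<Longrightarrow> A t > 0"
  by (rule A_pos_if) (auto intro: B_pos)

section \<open>Sign of the gap and monotonicity of \<open>B'\<close>\<close>

lemma gap_deriv:
  "t \<ge> a \<Longrightarrow> (gap has_real_derivative slope' (B t) * P t - deriv P t) (at t)"
  unfolding gap_def [abs_def]
  using DERIV_diff[OF DERIV_chain2[OF slope_deriv[OF B_pos] B_deriv] P_deriv] by blast

text \<open>Where the gap is nonpositive, the equation gives \<open>B'' \<le> 0\<close>, and the
  source \<open>slope' (B s) * P s\<close> alone makes the gap increase.\<close>

lemma gap_pos:
  assumes "t > a"
  shows "gap t > 0"
proof (rule positive_of_increasing_where_nonpos[OF assms])
  show "gap a \<ge> 0" by (simp add: gap_horizon)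
  show "continuous_on {a..t} gap"
    by (rule continuous_on_Icc_of_deriv, erule gap_deriv)
  fix s assume s: "a < s" "s \<le> t"
  show "(gap has_real_derivative slope' (B s) * P s - deriv P s) (at s)"
    using s by (intro gap_deriv) auto
  assume "gap s \<le> 0"
  then have "A s * deriv P s \<le> 0"
    using P_equation[of s] B_pos[of s] friction_pos[of "B s"] s by (simp add: mult_le_0_iff)
  then have "deriv P s \<le> 0" using A_pos[of s] s by (simp add: mult_le_0_iff)
  moreover have "slope' (B s) * P s > 0"
    using s by (intro mult_pos_pos slope'_bounds B_pos P_pos) auto
  ultimately show "slope' (B s) * P s - deriv P s > 0" by simp
qed

lemma P_strict_mono: "strict_mono_on {a..} P"
proof (rule strict_mono_onI)
  fix x y assume xy: "x \<in> {a..}" "y \<in> {a..}" "x < y"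
  \<comment> \<open>The horizon is excluded: \<open>A\<close> vanishes there, so the equation says
    nothing about \<open>B''\<close>. Continuity of \<open>P\<close> closes the interval.\<close>
  have "deriv P s > 0" if "s > x" for s
  proof -
    have "s > a" using that xy by simp
    then have "A s * deriv P s > 0"
      using P_equation[of s] B_pos[of s] friction_pos[of "B s"] gap_pos[of s] by simp
    then show ?thesis using A_pos[OF \<open>s > a\<close>] by (simp add: zero_less_mult_iff)
  qed
  moreover have "continuous_on {x..y} P"
    using P_cont[of y] xy by (auto intro: continuous_on_subset)
  ultimately show "P x < P y"
    using xy by (intro DERIV_pos_imp_increasing_open[of x y P]) (force intro!: P_deriv)+
qed

section \<open>Quantitative bounds and damping of the gap\<close>

lemma P_less: "t \<ge> a \<Longrightarrow> P t < 1 / 4"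
  using gap_pos[of t] gap_horizon slope_bounds(1)[OF B_pos, of t]
  by (cases "t = a") (auto simp: gap_def)

text \<open>\<open>friction\<close> is also the source of \<open>A\<close>. Once
  \<open>3 * A \<ge> friction\<close>, the damping gives \<open>3 * A' \<le> - friction\<close>,
  whereas \<open>0 < B' < 1/4\<close> lets \<open>friction (B t)\<close> fall at a rate of at most
  \<open>friction / 2\<close>.\<close>

lemma A_less:
  assumes "t > a"
  shows "3 * A t < friction (B t)"
proof -
  let ?F = "\<lambda>t. - 2 * friction (B t) + 8 * exp (- 12 * B t)"
  let ?h = "\<lambda>t. friction (B t) - 3 * A t"
  let ?h' = "\<lambda>t. ?F t * P t - 3 * (friction (B t) - 4 * A t * (1 + (P t)\<^sup>2))"
  have deriv: "(?h has_real_derivative ?h' s) (at s)" if "s \<ge> a" for s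
    by (intro DERIV_diff DERIV_cmult DERIV_chain2[OF friction_deriv] A_deriv B_deriv that)
  have "?h t > 0"
  proof (rule positive_of_increasing_where_nonpos[where h' = ?h', OF assms])
    show "?h a \<ge> 0" using friction_pos[OF beta_pos] by (simp add: A_horizon B_horizon)
    show "continuous_on {a..t} ?h"
      by (rule continuous_on_Icc_of_deriv, erule deriv)
    fix s assume s: "a < s" "s \<le> t"
    show "(?h has_real_derivative ?h' s) (at s)" using s by (intro deriv) simp
    assume "?h s \<le> 0"
    have F: "friction (B s) > 0" using friction_pos[OF B_pos] s by simp
    have "3 * A s * (1 + (P s)\<^sup>2) \<ge> friction (B s) * 1"
      using F \<open>?h s \<le> 0\<close> by (intro mult_mono) auto
    then have A: "4 * A s * (1 + (P s)\<^sup>2) \<ge> 4 / 3 * friction (B s)" by linarith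
    have "friction (B s) * P s \<le> friction (B s) * (1 / 4)"
      using P_less[of s] F s by (intro mult_left_mono) auto
    moreover have "?F s * P s \<ge> - 2 * friction (B s) * P s"
      using P_pos[of s] s by (intro mult_right_mono) auto
    ultimately have "?F s * P s \<ge> - friction (B s) / 2" by linarith
    \<comment> \<open>The worst case is
      \<open>- f / 2 - 3 * (f - 4 / 3 * f) = f / 2\<close>.\<close>
    moreover have "x - 3 * (f - y) > 0" if "4 / 3 * f \<le> y" "0 < f" "- f / 2 \<le> x" for x y f :: real
      using that by simp
    ultimately show "?h' s > 0" using A F by blast
  qed
  then show ?thesis by simp
qed

text \<open>The equation reads \<open>B'' = (friction / A) * gap\<close>, and \<open>A_less\<close>
  makes this damping rate exceed 3.\<close>

lemma gap_deriv_le: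
  assumes "t > a"
  shows "slope' (B t) * P t - deriv P t \<le> 3 * exp (- 10 * B t) * P t - 3 * gap t"
proof -
  have "A t * deriv P t = friction (B t) * gap t"
    using P_equation B_pos assms by simp
  also have "\<dots> \<ge> (3 * A t) * gap t"
    using A_less[OF assms] gap_pos[OF assms] by (intro mult_right_mono) auto
  finally have "A t * (3 * gap t) \<le> A t * deriv P t" by (simp add: algebra_simps)
  then have "3 * gap t \<le> deriv P t" using A_pos[OF assms] by simp
  moreover have "slope' (B t) * P t \<le> 3 * exp (- 10 * B t) * P t"
    using slope'_bounds(2)[OF B_pos] P_pos[of t] assms by (intro mult_right_mono) auto
  ultimately show ?thesis by simp
qed

text \<open>The deficit \<open>1/4 - B'\<close> is at most \<open>exp (-10 B) / 4 + gap\<close>, and both summands are dominated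
  by exact derivatives: \<open>(exp (-10 B))' = -10 B' exp (-10 B)\<close> with \<open>B' \<ge> B'(a)\<close>, and
  \<open>3 gap \<le> -(gap + 3/10 exp (-10 B))'\<close>.\<close>

lemma B_minus_quarter_bounded:
  obtains C where "\<And>t. t \<ge> a \<Longrightarrow> B t - t / 4 \<ge> C"
proof
  \<comment> \<open>In \<open>10 * c * u * P t\<close>, with \<open>u = exp (- 10 * B t)\<close>,
    the summand \<open>1 / (40 * P a)\<close> yields
    \<open>(u / 4) * (P t / P a) \<ge> u / 4\<close>, covering the deficit of \<open>slope\<close>;
    the summand \<open>1 / 10\<close> yields \<open>u * P t\<close>, covering the source of the
    gap.\<close>
  define c where "c = 1 / (40 * P a) + 1 / 10"
  \<comment> \<open>\<open>V\<close> is nondecreasing and lies below \<open>B t - t / 4\<close>,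
    because the subtracted terms are nonnegative; the witness for \<open>C\<close> is
    \<open>V a\<close>.\<close>
  define V where "V t = B t - t / 4 - c * exp (- 10 * B t) - gap t / 3" for t
  let ?V' = "\<lambda>t. P t - 1 / 4 + 10 * c * exp (- 10 * B t) * P t
    - (slope' (B t) * P t - deriv P t) / 3"
  have V_deriv: "(V has_real_derivative ?V' t) (at t)" if "t \<ge> a" for t
    unfolding V_def [abs_def]
    by (rule derivative_eq_intros B_deriv[OF that] gap_deriv[OF that] refl | simp)+
  have V'_nonneg: "?V' t \<ge> 0" if "t > a" for t
  proof -
    define u where "u = exp (- 10 * B t)"
    have "u > 0" unfolding u_def by simp
    have "P a \<le> P t"
      using P_strict_mono that by (auto intro: less_imp_le dest: strict_mono_onD)
    then have "P t / P a \<ge> 1" using P_horizon_pos by simp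
    then have "u / 4 * 1 \<le> u / 4 * (P t / P a)"
      using \<open>u > 0\<close> by (intro mult_left_mono) auto
    moreover have "10 * c * u * P t = u / 4 * (P t / P a) + u * P t"
      unfolding c_def using P_horizon_pos by (simp add: field_simps)
    moreover have "1 / 4 - P t \<le> u / 4 + gap t"
      using slope_bounds(2)[OF B_pos, of t] that unfolding u_def gap_def by simp
    moreover have "(slope' (B t) * P t - deriv P t) / 3 \<le> u * P t - gap t"
      using gap_deriv_le[OF that] unfolding u_def by simp
    ultimately show ?thesis unfolding u_def by simp
  qed
  fix t assume "t \<ge> a"
  have "V a \<le> V t"
  proof (rule DERIV_nonneg_imp_increasing_open[OF \<open>t \<ge> a\<close>])
    show "continuous_on {a..t} V"
      by (rule continuous_on_Icc_of_deriv, erule V_deriv)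
  next
    fix x assume "a < x"
    then show "\<exists>y. (V has_real_derivative y) (at x) \<and> 0 \<le> y"
      using V_deriv[OF less_imp_le] V'_nonneg by blast
  qed
  moreover have "gap t \<ge> 0" using gap_pos[of t] gap_horizon \<open>t \<ge> a\<close> by (cases "t = a") auto
  moreover have "c * exp (- 10 * B t) \<ge> 0" unfolding c_def using P_horizon_pos by simp
  ultimately show "B t - t / 4 \<ge> V a" unfolding V_def[of t] by simp
qed

text \<open>\<open>B'\<close> increases to a limit \<open>\<zeta>\<close> that it never exceeds, so
  \<open>\<zeta> * t - B t\<close> is nondecreasing; the lower bound on \<open>B t - t / 4\<close>
  bounds it above, and \<open>\<sigma>\<close> is minus its limit.\<close>

lemma asymptotics:
  "\<exists>\<zeta>>0. (P \<longlongrightarrow> \<zeta>) at_top \<and> (\<exists>\<sigma>. ((\<lambda>\<tau>. B \<tau> - \<zeta> * \<tau> - \<sigma>) \<longlongrightarrow> 0) at_top)"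
proof -
  obtain \<zeta> where lim: "(P \<longlongrightarrow> \<zeta>) at_top" and P_le: "\<And>t. t \<ge> a \<Longrightarrow> P t \<le> \<zeta>"
    using mono_bdd_above_tendsto_at_top[OF strict_mono_on_imp_mono_on[OF P_strict_mono]]
      P_less less_imp_le by metis
  have "\<zeta> > 0" using P_le[of a] P_horizon_pos by simp
  have "\<zeta> \<le> 1 / 4"
  proof (rule tendsto_upperbound[OF lim])
    show "\<forall>\<^sub>F t in at_top. P t \<le> 1 / 4"
      using eventually_ge_at_top[of a] by eventually_elim (rule less_imp_le[OF P_less])
  qed simp
  obtain C where C: "\<And>t. t \<ge> a \<Longrightarrow> B t - t / 4 \<ge> C"
    using B_minus_quarter_bounded by blast
  have "mono_on {a..} (\<lambda>t. \<zeta> * t - B t)"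
  proof (rule mono_onI)
    fix x y assume xy: "x \<in> {a..}" "y \<in> {a..}" "x \<le> y"
    show "\<zeta> * x - B x \<le> \<zeta> * y - B y"
    proof (rule DERIV_nonneg_imp_nondecreasing[OF \<open>x \<le> y\<close>])
      fix t assume "x \<le> t"
      then have "t \<ge> a" using xy by simp
      then have "((\<lambda>t. \<zeta> * t - B t) has_real_derivative \<zeta> - P t) (at t)"
        by (auto intro!: derivative_eq_intros B_deriv)
      then show "\<exists>y. ((\<lambda>t. \<zeta> * t - B t) has_real_derivative y) (at t) \<and> 0 \<le> y"
        using P_le[OF \<open>t \<ge> a\<close>] by force
    qed
  qed
  \<comment> \<open>Write \<open>\<zeta> * t - B t\<close> as
    \<open>(t / 4 - B t) - (1 / 4 - \<zeta>) * t\<close>; since \<open>\<zeta> \<le> 1 / 4\<close>,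
    the last term is largest at \<open>t = a\<close>, where \<open>a\<close> may be
    negative.\<close>
  moreover have "\<zeta> * t - B t \<le> - C - (1 / 4 - \<zeta>) * a" if "t \<ge> a" for t
  proof -
    have "(1 / 4 - \<zeta>) * a \<le> (1 / 4 - \<zeta>) * t"
      using that \<open>\<zeta> \<le> 1 / 4\<close> by (intro mult_left_mono) auto
    then show ?thesis using C[OF that] by (simp add: algebra_simps)
  qed
  ultimately obtain l where "((\<lambda>t. \<zeta> * t - B t) \<longlongrightarrow> l) at_top"
    by (rule mono_bdd_above_tendsto_at_top)
  then have "((\<lambda>t. - (\<zeta> * t - B t) - (- l)) \<longlongrightarrow> - l - (- l)) at_top"
    by (intro tendsto_intros)
  then have "((\<lambda>t. B t - \<zeta> * t - (- l)) \<longlongrightarrow> 0) at_top" by simp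
  then show ?thesis using lim \<open>\<zeta> > 0\<close> by blast
qed

end

theorem mainTheorem2:
  fixes r_H \<beta> :: real and A B :: "real \<Rightarrow> real"
  assumes "r_H > 0" and "\<beta> > 0"
    and "warped_black_hole (ln r_H) \<beta> A B"
  shows "strict_mono_on {ln r_H..} (deriv B) \<and>
    (\<exists>\<zeta>>0. (deriv B \<longlongrightarrow> \<zeta>) at_top \<and>
       (\<exists>\<sigma>. ((\<lambda>\<tau>. B \<tau> - \<zeta> * \<tau> - \<sigma>) \<longlongrightarrow> 0) at_top))"
proof -
  interpret warped "ln r_H" \<beta> A B using assms(2,3) by unfold_locales
  show ?thesis using P_strict_mono asymptotics by blast
qed

end
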